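(* Let $\varepsilon>0$ be fixed, let $\lambda>0$, and let $u$ be a solution of $$\frac1r\left(\frac{r u'}{\sqrt{1+\varepsilon^2(u')^2}}\right)'=\frac{\lambda}{(1+u)^2},\quad 0<r<1;\qquad u'(0)=u(1)=0,$$ with $u(0)=\alpha$. (a) If $\lambda\le (4+3\sqrt2)/\varepsilon^2$, then $$\alpha\ \ge\ -1+\frac{3-2\sqrt2}{2}\,\varepsilon^2\lambda\ >\ -1.$$ (b) If $\lambda>(4+3\sqrt2)/\varepsilon^2$, then $$\alpha\ \ge\ \frac{\varepsilon\sqrt{\lambda(\varepsilon^2\lambda-8)}-\varepsilon^2\lambda-4}{4(\varepsilon^2\lambda+1)}\ >\ -1.$$
   Context: A solution is a classical one: $u\in C([0,1])\cap C^1([0,1))\cap C^2((0,1))$, with values $u(r)\in(-1,0]$, satisfying the differential equation on $(0,1)$ and the conditions $u'(0)=0$, $u(1)=0$. *)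

theory Defs
  imports "HOL-Analysis.Analysis"
begin

text \<open>
  Classical solutions
  \<open>u \<in> C([0,1]) \<inter> C\<^sup>1([0,1)) \<inter> C\<^sup>2((0,1))\<close> with values in \<open>(-1,0]\<close>. Only the values of \<open>u\<close> on
  \<open>[0,1]\<close> matter, so the derivative on \<open>[0,1)\<close> is taken within that interval, i.e. it is one-sided
  at \<open>0\<close>; at interior points it is the ordinary derivative. The \<open>C\<^sup>2\<close> condition makes the flux
  \<open>s u'/\<surd>(1 + \<epsilon>\<^sup>2 u'\<^sup>2)\<close> differentiable on \<open>(0,1)\<close>, so the use of \<^const>\<open>deriv\<close> is unproblematic.
\<close>

definition radial_mems_solution :: "real \<Rightarrow> real \<Rightarrow> (real \<Rightarrow> real) \<Rightarrow> bool" where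
  "radial_mems_solution \<epsilon> lam u \<longleftrightarrow>
     continuous_on {0..1} u \<and>
     (\<forall>r\<in>{0..1}. u r \<in> {-1<..0}) \<and>
     (\<exists>u' u''.
        (\<forall>r\<in>{0..<1}. (u has_real_derivative u' r) (at r within {0..<1})) \<and>
        continuous_on {0..<1} u' \<and>
        (\<forall>r\<in>{0<..<1}. (u' has_real_derivative u'' r) (at r)) \<and>
        continuous_on {0<..<1} u'' \<and>
        (\<forall>r\<in>{0<..<1}.
           1 / r * deriv (\<lambda>s. s * u' s / sqrt (1 + \<epsilon>\<^sup>2 * (u' s)\<^sup>2)) r = lam / (1 + u r)\<^sup>2) \<and>
        u' 0 = 0 \<and> u 1 = 0)"

end

theory Submission
  imports Defs
begin

text \<open>
  Write \<open>m = 1 + u\<close>, \<open>m\<^sub>0 = 1 + u 0\<close> and \<open>q = u' / \<surd>(1 + \<epsilon>\<^sup>2 u'\<^sup>2)\<close>, so that \<open>(r q)' = \<lambda> r / m\<^sup>2\<close>.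
  Hence \<open>q \<ge> 0\<close>, \<open>u\<close> is nondecreasing, and \<open>q / r \<le> \<lambda> / (2 m\<^sub>0\<^sup>2)\<close>. Multiplying
  \<open>q' = \<lambda> / m\<^sup>2 - q / r \<ge> \<lambda> / m\<^sup>2 - \<lambda> / (2 m\<^sub>0\<^sup>2)\<close> by \<open>u'\<close> and integrating bounds
  \<open>(1 - 1 / \<surd>(1 + \<epsilon>\<^sup>2 u'\<^sup>2)) / \<epsilon>\<^sup>2\<close> from below. As this quantity is less than \<open>1 / \<epsilon>\<^sup>2\<close>, we get
  \<open>\<epsilon>\<^sup>2 \<lambda> (m - m\<^sub>0) (2 m\<^sub>0 - m) \<le> 2 m\<^sub>0\<^sup>2 m\<close> for every value \<open>m \<in> [m\<^sub>0, 1]\<close>. The optimal choice is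
  \<open>m = \<surd>2 m\<^sub>0\<close> if this is at most \<open>1\<close>, and \<open>m = 1\<close> otherwise.
\<close>

text \<open>The quotient rule leaves the numerator
  \<open>S\<^sup>2 - e\<^sup>2 * (p r)\<^sup>2\<close>, which collapses to 1.\<close>

lemma DERIV_div_sqrt_one_plus_square:
  assumes "(p has_real_derivative p') (at r)"
  shows "((\<lambda>s. p s / sqrt (1 + e\<^sup>2 * (p s)\<^sup>2)) has_real_derivative
           p' / (sqrt (1 + e\<^sup>2 * (p r)\<^sup>2))^3) (at r)"
proof -
  define S where "S = sqrt (1 + e\<^sup>2 * (p r)\<^sup>2)"
  have pos: "1 + e\<^sup>2 * (p r)\<^sup>2 > 0" by (simp add: add_pos_nonneg)
  have S: "S > 0" "S\<^sup>2 = 1 + e\<^sup>2 * (p r)\<^sup>2" using pos by (auto simp: S_def)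
  have "((\<lambda>s. p s / sqrt (1 + e\<^sup>2 * (p s)\<^sup>2)) has_real_derivative
          (p' * S - p r * (e\<^sup>2 * (2 * p r * p') * (inverse S / 2))) / (S * S)) (at r)"
    using pos assms S(1) unfolding S_def
    by (auto intro!: derivative_eq_intros simp: algebra_simps)
  moreover have "(p' * S - p r * (e\<^sup>2 * (2 * p r * p') * (inverse S / 2))) / (S * S)
      = p' * (S\<^sup>2 - e\<^sup>2 * (p r)\<^sup>2) / S^3"
    using S(1) by (simp add: field_simps power2_eq_square power3_eq_cube)
  ultimately show ?thesis using S by (simp add: S_def)
qed

text \<open>Together with the previous derivative this shows that -1 / (\<open>e\<^sup>2\<close>
  \<open>S\<close>) is an antiderivative of p q', for q = p / S and e nonzero.\<close>

lemma DERIV_inverse_sqrt_one_plus_square: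
  assumes "(p has_real_derivative p') (at r)"
  shows "((\<lambda>s. 1 / sqrt (1 + e\<^sup>2 * (p s)\<^sup>2)) has_real_derivative
           - (e\<^sup>2 * p r * p') / (sqrt (1 + e\<^sup>2 * (p r)\<^sup>2))^3) (at r)"
proof -
  define S where "S = sqrt (1 + e\<^sup>2 * (p r)\<^sup>2)"
  have pos: "1 + e\<^sup>2 * (p r)\<^sup>2 > 0" by (simp add: add_pos_nonneg)
  have S: "S > 0" using pos by (auto simp: S_def)
  have "((\<lambda>s. 1 / sqrt (1 + e\<^sup>2 * (p s)\<^sup>2)) has_real_derivative
          - (e\<^sup>2 * (2 * p r * p') * (inverse S / 2)) / (S * S)) (at r)"
    using pos assms S unfolding S_def
    by (auto intro!: derivative_eq_intros simp: algebra_simps)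
  moreover have "- (e\<^sup>2 * (2 * p r * p') * (inverse S / 2)) / (S * S) = - (e\<^sup>2 * p r * p') / S^3"
    using S by (simp add: field_simps power3_eq_cube)
  ultimately show ?thesis by (simp add: S_def)
qed

text \<open>Denominators are cleared and \<open>r\<close> is left free, so that the value
  \<open>1 + u r\<close> can be chosen afterwards.\<close>

lemma radial_mems_energy_bound:
  assumes e: "\<epsilon> > 0" and l: "lam > 0" and sol: "radial_mems_solution \<epsilon> lam u"
    and r: "r \<in> {0..1}"
  shows "\<epsilon>\<^sup>2 * lam * (u r - u 0) * (2 * (1 + u 0) - (1 + u r)) \<le> 2 * (1 + u 0)\<^sup>2 * (1 + u r)"
proof -
  obtain p p' where
    cu: "continuous_on {0..1} u" and
    range: "\<And>r. r \<in> {0..1} \<Longrightarrow> -1 < u r \<and> u r \<le> 0" and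
    du0: "\<And>r. r \<in> {0..<1} \<Longrightarrow> (u has_real_derivative p r) (at r within {0..<1})" and
    cp: "continuous_on {0..<1} p" and
    dp: "\<And>r. r \<in> {0<..<1} \<Longrightarrow> (p has_real_derivative p' r) (at r)" and
    ode: "\<And>r. r \<in> {0<..<1} \<Longrightarrow>
      1 / r * deriv (\<lambda>s. s * p s / sqrt (1 + \<epsilon>\<^sup>2 * (p s)\<^sup>2)) r = lam / (1 + u r)\<^sup>2" and
    p0: "p 0 = 0"
    using sol unfolding radial_mems_solution_def by fastforce
  define S where "S r = sqrt (1 + \<epsilon>\<^sup>2 * (p r)\<^sup>2)" for r
  define q where "q r = p r / S r" for r
  define m where "m r = 1 + u r" for r
  have S: "S r > 0" for r by (simp add: S_def add_pos_nonneg)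
  have m: "m r > 0" if "r \<in> {0..1}" for r using range[OF that] by (simp add: m_def)
  have m0: "m 0 > 0" by (simp add: m)
  have du: "(u has_real_derivative p r) (at r)" if "r \<in> {0<..<1}" for r
  proof -
    have "(u has_real_derivative p r) (at r within {0<..<1})"
      by (rule DERIV_subset[OF du0]) (use that in auto)
    then show ?thesis using that by (metis at_within_open open_greaterThanLessThan)
  qed
  have dm: "(m has_real_derivative p r) (at r)" if "r \<in> {0<..<1}" for r
    unfolding m_def using du[OF that] by (auto intro!: derivative_eq_intros)
  have cm: "continuous_on {0..1} m" unfolding m_def by (intro continuous_intros cu)
  have cS: "continuous_on {0..<1} S" unfolding S_def by (intro continuous_intros cp)
  have cq: "continuous_on {0..<1} q"
    unfolding q_def by (intro continuous_intros cp cS) (use S in \<open>auto simp: less_imp_neq[symmetric]\<close>)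
  have dq: "(q has_real_derivative p' r / S r ^ 3) (at r)" if "r \<in> {0<..<1}" for r
    using DERIV_div_sqrt_one_plus_square[OF dp[OF that]] unfolding q_def S_def .
  have dF: "((\<lambda>s. s * q s) has_real_derivative q r + r * (p' r / S r ^ 3)) (at r)"
    if "r \<in> {0<..<1}" for r
    using dq[OF that] by (auto intro!: derivative_eq_intros)
  have flux: "q r + r * (p' r / S r ^ 3) = lam * r / (m r)\<^sup>2" if r: "r \<in> {0<..<1}" for r
  proof -
    have "deriv (\<lambda>s. s * q s) r = q r + r * (p' r / S r ^ 3)"
      by (rule DERIV_imp_deriv[OF dF[OF r]])
    moreover have "(\<lambda>s. s * q s) = (\<lambda>s. s * p s / sqrt (1 + \<epsilon>\<^sup>2 * (p s)\<^sup>2))"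
      by (simp add: q_def S_def)
    ultimately show ?thesis using ode[OF r] r by (simp add: m_def field_simps)
  qed
  have q_nonneg: "q r \<ge> 0" if r: "r \<in> {0<..<1}" for r
  proof -
    \<comment> \<open>The flux s q(s) vanishes at 0, and by \<open>flux\<close> its derivative is
      nonnegative.\<close>
    have "0 * q 0 \<le> r * q r"
    proof (rule DERIV_nonneg_imp_increasing_open[where f = "\<lambda>s. s * q s"])
      show "\<exists>y. ((\<lambda>s. s * q s) has_real_derivative y) (at x) \<and> 0 \<le> y" if "0 < x" "x < r" for x
        using dF[of x] flux[of x] that r l m[of x] by auto
      show "continuous_on {0..r} (\<lambda>s. s * q s)"
        by (intro continuous_intros continuous_on_subset[OF cq]) (use r in auto)
    qed (use r in auto)
    then show ?thesis using r by (simp add: zero_le_mult_iff)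
  qed
  have p_nonneg: "p r \<ge> 0" if "r \<in> {0<..<1}" for r
    using q_nonneg[OF that] S[of r] by (simp add: q_def zero_le_divide_iff)
  have m_ge: "m 0 \<le> m r" if r: "r \<in> {0<..<1}" for r
  proof (rule DERIV_nonneg_imp_increasing_open[where f = m])
    show "\<exists>y. (m has_real_derivative y) (at x) \<and> 0 \<le> y" if "0 < x" "x < r" for x
      using dm[of x] p_nonneg[of x] that r by auto
    show "continuous_on {0..r} m"
      by (intro continuous_on_subset[OF cm]) (use r in auto)
  qed (use r in auto)
  have q_le: "q r / r \<le> lam / (2 * (m 0)\<^sup>2)" if r: "r \<in> {0<..<1}" for r
  proof -
    \<comment> \<open>Since m \<ge> m(0), the derivative of s q(s) is at most
      \<open>lam * s / (m 0)\<^sup>2\<close>. The first term of \<open>G\<close> is the integral of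
      this bound, so \<open>G\<close> increases from 0.\<close>
    define G where "G s = lam / (2 * (m 0)\<^sup>2) * s\<^sup>2 - s * q s" for s
    have "G 0 \<le> G r"
    proof (rule DERIV_nonneg_imp_increasing_open[where f = G])
      show "\<exists>y. (G has_real_derivative y) (at x) \<and> 0 \<le> y" if x: "0 < x" "x < r" for x
      proof (intro exI conjI)
        have x': "x \<in> {0<..<1}" using x r by auto
        have "((\<lambda>s. lam / (2 * (m 0)\<^sup>2) * s\<^sup>2) has_real_derivative lam * x / (m 0)\<^sup>2) (at x)"
          using m0 by (auto intro!: derivative_eq_intros simp: field_simps)
        then show "(G has_real_derivative lam * x / (m 0)\<^sup>2 - (q x + x * (p' x / S x ^ 3))) (at x)"
          unfolding G_def by (rule DERIV_diff[OF _ dF[OF x']])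
        have "(m 0)\<^sup>2 \<le> (m x)\<^sup>2" using m_ge[OF x'] m0 by (intro power_mono) auto
        then have "lam * x / (m x)\<^sup>2 \<le> lam * x / (m 0)\<^sup>2"
          using m0 l x by (intro divide_left_mono) (auto simp: zero_less_mult_iff m[of x])
        then show "0 \<le> lam * x / (m 0)\<^sup>2 - (q x + x * (p' x / S x ^ 3))"
          using flux[OF x'] by simp
      qed
      show "continuous_on {0..r} G"
        unfolding G_def by (intro continuous_intros continuous_on_subset[OF cq]) (use r in auto)
    qed (use r in auto)
    then have "r * q r \<le> r * (lam / (2 * (m 0)\<^sup>2) * r)"
      by (simp add: G_def power2_eq_square mult_ac)
    then have "q r \<le> lam / (2 * (m 0)\<^sup>2) * r" using r by (subst (asm) mult_le_cancel_left_pos) auto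
    then show ?thesis using r by (subst pos_divide_le_eq) auto
  qed
  define D where "D r = 2 * (m 0)\<^sup>2 * m r - \<epsilon>\<^sup>2 * lam * (m r - m 0) * (2 * m 0 - m r)" for r
  have interior: "0 \<le> D r"
    if r: "r \<in> {0<..<1}" for r
  proof -
    define c where "c = lam / (2 * (m 0)\<^sup>2)"
    define w where "w s = 1 / S s" for s
    \<comment> \<open>The three terms are antiderivatives of p q', -\<open>lam\<close> p /
      \<open>m\<^sup>2\<close> and c p. By the equation their sum has derivative p (c - q / s),
      which is nonnegative by \<open>q_le\<close>.\<close>
    define H where "H s = - w s / \<epsilon>\<^sup>2 + lam / m s + c * m s" for s
    have "H 0 \<le> H r"
    proof (rule DERIV_nonneg_imp_increasing_open[where f = H])
      show "\<exists>y. (H has_real_derivative y) (at x) \<and> 0 \<le> y" if x: "0 < x" "x < r" for x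
      proof (intro exI conjI)
        have x': "x \<in> {0<..<1}" using x r by auto
        have mx: "m x > 0" using x' m by simp
        have dw: "(w has_real_derivative - (\<epsilon>\<^sup>2 * p x * p' x) / S x ^ 3) (at x)"
          using DERIV_inverse_sqrt_one_plus_square[OF dp[OF x']] unfolding w_def S_def .
        have "(H has_real_derivative
            - (- (\<epsilon>\<^sup>2 * p x * p' x) / S x ^ 3) / \<epsilon>\<^sup>2 - lam * p x / (m x)\<^sup>2 + c * p x) (at x)"
          unfolding H_def using mx
          by (auto intro!: derivative_eq_intros dw dm[OF x'] simp: power2_eq_square)
        moreover have "- (- (\<epsilon>\<^sup>2 * p x * p' x) / S x ^ 3) / \<epsilon>\<^sup>2 - lam * p x / (m x)\<^sup>2 + c * p x
            = p x * (p' x / S x ^ 3 - lam / (m x)\<^sup>2 + c)"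
          using e by (simp add: algebra_simps)
        moreover have "p' x / S x ^ 3 - lam / (m x)\<^sup>2 = - (q x / x)"
        proof -
          have "x * (p' x / S x ^ 3) = lam * x / (m x)\<^sup>2 - q x" using flux[OF x'] by linarith
          then have "p' x / S x ^ 3 = (lam * x / (m x)\<^sup>2 - q x) / x" using x(1)
            by (simp add: eq_divide_eq mult.commute)
          then show ?thesis using x(1) by (simp add: diff_divide_distrib)
        qed
        ultimately show "(H has_real_derivative p x * (c - q x / x)) (at x)" by simp
        show "0 \<le> p x * (c - q x / x)"
          using p_nonneg[OF x'] q_le[OF x'] by (simp add: c_def)
      qed
      have "continuous_on {0..r} S" "continuous_on {0..r} m"
        using r by (auto intro: continuous_on_subset[OF cS] continuous_on_subset[OF cm])
      moreover have "\<forall>s\<in>{0..r}. S s \<noteq> 0" "\<forall>s\<in>{0..r}. m s \<noteq> 0"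
        using S m r by (auto simp: less_imp_neq[symmetric])
      ultimately show "continuous_on {0..r} H"
        unfolding H_def w_def using e by (intro continuous_intros) auto
    qed (use r in auto)
    moreover have "w 0 = 1" by (simp add: w_def S_def p0)
    \<comment> \<open>Dropping this term removes the unknown slope at r. What remains of
      \<open>H 0 \<le> H r\<close> involves only m(0) and m(r).\<close>
    moreover have "w r / \<epsilon>\<^sup>2 > 0" using S[of r] e by (simp add: w_def)
    ultimately have "-1 / \<epsilon>\<^sup>2 + lam / m 0 + c * m 0 \<le> lam / m r + c * m r"
      by (simp add: H_def)
    then have "(-1 / \<epsilon>\<^sup>2 + lam / m 0 + c * m 0) * (2 * (m 0)\<^sup>2 * m r * \<epsilon>\<^sup>2)
        \<le> (lam / m r + c * m r) * (2 * (m 0)\<^sup>2 * m r * \<epsilon>\<^sup>2)"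
      using m[of r] r by (intro mult_right_mono) auto
    moreover have "(-1 / \<epsilon>\<^sup>2 + lam / m 0 + c * m 0) * (2 * (m 0)\<^sup>2 * m r * \<epsilon>\<^sup>2)
        = - 2 * (m 0)\<^sup>2 * m r + 3 * lam * m 0 * m r * \<epsilon>\<^sup>2"
      using e m0 by (simp add: c_def field_simps power2_eq_square)
    moreover have "(lam / m r + c * m r) * (2 * (m 0)\<^sup>2 * m r * \<epsilon>\<^sup>2)
        = 2 * lam * (m 0)\<^sup>2 * \<epsilon>\<^sup>2 + lam * (m r)\<^sup>2 * \<epsilon>\<^sup>2"
      using m0 m[of r] r by (simp add: c_def field_simps power2_eq_square)
    ultimately show ?thesis by (simp add: D_def algebra_simps power2_eq_square)
  qed
  have "0 \<le> D r"
  \<comment> \<open>The slope p is controlled only on [0,1), but \<open>D\<close> contains just m,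
    so continuity carries the inequality to the endpoint 1.\<close>
  proof (rule continuous_ge_on_closure[where f = D])
    show "continuous_on (closure {0<..<1}) D"
      unfolding D_def using cm by (auto intro!: continuous_intros)
    show "r \<in> closure {0<..<1}" using r by simp
  qed (rule interior)
  then show ?thesis by (simp add: D_def m_def)
qed

text \<open>A convex quadratic is negative only strictly between its roots. Hence y lies between
  them, and a point x to the right of y with nonnegative value lies at or beyond the larger
  root.\<close>

lemma larger_root_le:
  fixes a b c x :: real
  assumes a: "a > 0" and x: "a * x\<^sup>2 + b * x + c \<ge> 0"
    and y: "a * y\<^sup>2 + b * y + c < 0" "y \<le> x"
  shows "(sqrt (b\<^sup>2 - 4 * a * c) - b) / (2 * a) \<le> x"
proof -
  define D where "D = b\<^sup>2 - 4 * a * c"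
  have sq: "(2 * a * z + b)\<^sup>2 - D = 4 * a * (a * z\<^sup>2 + b * z + c)" for z
    by (simp add: D_def algebra_simps power2_eq_square)
  have "D \<le> (2 * a * x + b)\<^sup>2" using sq[of x] a x by (smt (verit) mult_nonneg_nonneg)
  then have X: "sqrt D \<le> \<bar>2 * a * x + b\<bar>" by (metis real_sqrt_abs real_sqrt_le_iff)
  have "(2 * a * y + b)\<^sup>2 < D" using sq[of y] a y by (smt (verit) mult_pos_neg)
  then have Y: "\<bar>2 * a * y + b\<bar> < sqrt D" by (metis real_sqrt_abs real_sqrt_less_iff)
  have "2 * a * y \<le> 2 * a * x" using a y by simp
  \<comment> \<open>\<open>X\<close> leaves the alternative 2ax + b \<le> -sqrt D, which is excluded
    by 2ax + b \<ge> 2ay + b > -sqrt D.\<close>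
  with X Y have "sqrt D \<le> 2 * a * x + b" by linarith
  then show ?thesis using a by (simp add: D_def field_simps)
qed

theorem theorem3p4:
  fixes \<epsilon> lam \<alpha> :: real and u :: "real \<Rightarrow> real"
  assumes "\<epsilon> > 0" and "lam > 0"
    and "radial_mems_solution \<epsilon> lam u"
    and "u 0 = \<alpha>"
  shows "(lam \<le> (4 + 3 * sqrt 2) / \<epsilon>\<^sup>2 \<longrightarrow>
            \<alpha> \<ge> -1 + (3 - 2 * sqrt 2) / 2 * \<epsilon>\<^sup>2 * lam \<and>
            -1 + (3 - 2 * sqrt 2) / 2 * \<epsilon>\<^sup>2 * lam > -1) \<and>
         (lam > (4 + 3 * sqrt 2) / \<epsilon>\<^sup>2 \<longrightarrow>
            \<alpha> \<ge> (\<epsilon> * sqrt (lam * (\<epsilon>\<^sup>2 * lam - 8)) - \<epsilon>\<^sup>2 * lam - 4) / (4 * (\<epsilon>\<^sup>2 * lam + 1)) \<and>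
            (\<epsilon> * sqrt (lam * (\<epsilon>\<^sup>2 * lam - 8)) - \<epsilon>\<^sup>2 * lam - 4) / (4 * (\<epsilon>\<^sup>2 * lam + 1)) > -1)"
proof -
  define b where "b = \<epsilon>\<^sup>2 * lam"
  define k where "k = (3 - 2 * sqrt 2) / 2"
  define m where "m = 1 + \<alpha>"
  have b: "b > 0" using assms by (simp add: b_def)
  have sqrt2: "sqrt 2 * sqrt 2 = (2::real)" "1 < sqrt (2::real)" by auto
  have "sqrt 2 < (3/2::real)" by (rule real_less_lsqrt) (auto simp: power2_eq_square)
  then have k: "k > 0" by (simp add: k_def)
  have two_k: "2 * k = 3 - 2 * sqrt 2" by (simp add: k_def)
  \<comment> \<open>At the threshold b = 4 + 3 sqrt 2 the bound \<open>k * b\<close> equals sqrt 2 /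
    2, the value of m at which sqrt 2 m reaches 1 = 1 + u(1).\<close>
  have k_thr: "k * (4 + 3 * sqrt 2) = sqrt 2 / 2"
    using sqrt2(1) by (simp add: k_def field_simps)
  have cont: "continuous_on {0..1} u" and u1: "u 1 = 0"
    and range: "\<And>r. r \<in> {0..1} \<Longrightarrow> -1 < u r"
    using assms(3) unfolding radial_mems_solution_def by auto
  have m: "m > 0" using range[of 0] assms(4) by (simp add: m_def)
  have bound: "b * ((1 + u r) - m) * (2 * m - (1 + u r)) \<le> 2 * m\<^sup>2 * (1 + u r)"
    if "r \<in> {0..1}" for r
    using radial_mems_energy_bound[OF assms(1-3) that] assms(4) by (simp add: b_def m_def)
  \<comment> \<open>With x = 1 + u(r), the bound reads b (x - m)(2m - x) / x \<le>
    \<open>2 * m\<^sup>2\<close>. Its left side is largest at x = sqrt 2 m, and the condition on m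
    makes this a value of 1 + u.\<close>
  have small: "k * b \<le> m" if le: "m \<le> sqrt 2 / 2"
  proof -
    have "sqrt 2 * m \<le> 1" using mult_left_mono[OF le, of "sqrt 2"] sqrt2 by simp
    moreover have "m \<le> sqrt 2 * m" using sqrt2 m by simp
    ultimately obtain r where r: "r \<in> {0..1}" "u r = sqrt 2 * m - 1"
      using IVT'[of u 0 "sqrt 2 * m - 1" 1] cont u1 assms(4) by (auto simp: m_def)
    have "1 + u r = sqrt 2 * m" using r(2) by simp
    then have "b * (sqrt 2 * m - m) * (2 * m - sqrt 2 * m) \<le> 2 * m\<^sup>2 * (sqrt 2 * m)"
      using bound[OF r(1)] by simp
    moreover have "b * (sqrt 2 * m - m) * (2 * m - sqrt 2 * m) = (2 * sqrt 2 * m\<^sup>2) * (k * b)"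
    proof -
      have 1: "b * (t * m - m) * (2 * m - t * m) = b * m\<^sup>2 * ((t - 1) * (2 - t))" for t
        by (simp add: algebra_simps power2_eq_square)
      have 2: "(sqrt 2 - 1) * (2 - sqrt 2) = sqrt 2 * (2 * k)"
        using sqrt2(1) unfolding two_k by (simp add: algebra_simps)
      show ?thesis unfolding 1 2 by simp
    qed
    moreover have "2 * m\<^sup>2 * (sqrt 2 * m) = (2 * sqrt 2 * m\<^sup>2) * m" by simp
    ultimately have "(2 * sqrt 2 * m\<^sup>2) * (k * b) \<le> (2 * sqrt 2 * m\<^sup>2) * m" by linarith
    then show ?thesis using m by (simp add: mult_le_cancel_left)
  qed
  \<comment> \<open>If m exceeds sqrt 2 / 2, then \<open>k_thr\<close> already gives k b \<le> sqrt
    2 / 2 < m.\<close>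
  have a: "k * b \<le> m" if "lam \<le> (4 + 3 * sqrt 2) / \<epsilon>\<^sup>2"
  proof (cases "m \<le> sqrt 2 / 2")
    case False
    have "b \<le> 4 + 3 * sqrt 2" using that assms(1) by (simp add: b_def field_simps)
    then have "k * b \<le> sqrt 2 / 2"
      unfolding k_thr[symmetric] using k by (intro mult_left_mono) auto
    then show ?thesis using False by simp
  qed (rule small)
  have c: "(\<epsilon> * sqrt (lam * (b - 8)) - b - 4) / (4 * (b + 1)) \<le> \<alpha> \<and>
      (\<epsilon> * sqrt (lam * (b - 8)) - b - 4) / (4 * (b + 1)) > -1"
    if "lam > (4 + 3 * sqrt 2) / \<epsilon>\<^sup>2"
  proof -
    have b_gt: "b > 4 + 3 * sqrt 2" using that assms(1) by (simp add: b_def field_simps)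
    have root: "\<epsilon> * sqrt (lam * (b - 8)) = sqrt (b * (b - 8))"
      using assms(1) by (simp add: b_def real_sqrt_mult)
    have "k * b > sqrt 2 / 2"
      unfolding k_thr[symmetric] using k b_gt by (intro mult_strict_left_mono) auto
    then have m_gt: "m > sqrt 2 / 2" using small by fastforce
    \<comment> \<open>The energy bound at r = 1, where 1 + u = 1, rewritten as a quadratic in
      \<alpha>.\<close>
    have q1: "2 * (b + 1) * \<alpha>\<^sup>2 + (b + 4) * \<alpha> + 2 \<ge> 0"
      using bound[of 1] u1 by (simp add: m_def algebra_simps power2_eq_square)
    \<comment> \<open>The point sqrt 2 / 2 - 1 lies below \<alpha> by \<open>m_gt\<close> and serves
      as y in \<open>larger_root_le\<close>. The quadratic vanishes there for b = 4 + 3 sqrt 2 and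
      is negative for larger b.\<close>
    have "2 * (b + 1) * (s - 1)\<^sup>2 + (b + 4) * (s - 1) + 2 = 1 - b * (3 * s - 2)"
      if "2 * s * s = 1" for s using that by algebra
    from this[of "sqrt 2 / 2"]
    have "2 * (b + 1) * (sqrt 2 / 2 - 1)\<^sup>2 + (b + 4) * (sqrt 2 / 2 - 1) + 2
        = 1 - b * (3 * (sqrt 2 / 2) - 2)"
      by simp
    moreover have "3 * (sqrt 2 / 2) - 2 = (3 * sqrt 2 - 4) / (2::real)"
      by (simp add: diff_divide_distrib)
    then have "b * (3 * (sqrt 2 / 2) - 2) = b * (3 * sqrt 2 - 4) / 2"
      by (simp only: times_divide_eq_right)
    moreover have "b * (3 * sqrt 2 - 4) > (4 + 3 * sqrt 2) * (3 * sqrt 2 - 4)"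
      by (rule mult_strict_right_mono[OF b_gt])
        (use real_less_rsqrt[of "4/3" 2] in \<open>simp add: power2_eq_square\<close>)
    moreover have "(4 + 3 * sqrt 2) * (3 * sqrt 2 - 4) = (2::real)"
      using sqrt2(1) by (simp add: algebra_simps)
    ultimately have q2: "2 * (b + 1) * (sqrt 2 / 2 - 1)\<^sup>2 + (b + 4) * (sqrt 2 / 2 - 1) + 2 < 0"
      by linarith
    have "(b + 4)\<^sup>2 - 4 * (2 * (b + 1)) * 2 = b * (b - 8)"
      by (simp add: algebra_simps power2_eq_square)
    then have "(sqrt (b * (b - 8)) - b - 4) / (4 * (b + 1)) \<le> \<alpha>"
      using larger_root_le[OF _ q1 q2] b m_gt by (simp add: m_def algebra_simps)
    \<comment> \<open>From sqrt 2 > 4/3. It makes the radicand positive, which matters because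
      \<open>sqrt\<close> takes negative values at negative arguments.\<close>
    moreover have "b > 8"
      using b_gt real_less_rsqrt[of "4/3" 2] by (simp add: power2_eq_square)
    then have "0 \<le> sqrt (b * (b - 8))" by simp
    moreover have "(w - b - 4) / (4 * (b + 1)) > -1" if "0 \<le> w" for w
      using that b by (simp add: field_simps)
    ultimately show ?thesis by (simp add: root)
  qed
  have kb: "k * b > 0" using k b by simp
  have e1: "(3 - 2 * sqrt 2) / 2 * \<epsilon>\<^sup>2 * lam = k * b" by (simp add: k_def b_def)
  show ?thesis
    unfolding e1 using a c kb by (auto simp: m_def b_def)
qed

end
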